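(* Let $p>q\ge1$ and $m^{\frac1q-\frac1p}\ge r\ge1$, and let $\mathcal{U}=\mathcal{U}_1\cap\mathcal{U}_2$ where $\mathcal{U}_1=\{h\in\mathbb{R}^m_+:\|h\|_p\le1\}$ and $\mathcal{U}_2=\{h\in\mathbb{R}^m_+:\|h\|_q\le r\}$. Put $$\beta=\min(\beta_1,\beta_2),\qquad \beta_1=r^{\frac{1-p}{p}}m^{\frac{p-1}{pq}},\qquad \beta_2=r^{\frac1q}m^{\frac{q-1}{q^2}}.$$ Then the set $\hat{\mathcal{U}}=\beta\cdot\mathrm{conv}\big(e_1,\dots,e_m,(r\,m^{-1/q})\,e\big)$ dominates $\mathcal{U}$, and the piecewise affine solution described in the context (with this $\beta$ and $\gamma=r\,m^{-1/q}$) gives a $2\beta$-approximation to $\Pi_{AR}(\mathcal{U})$.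
   Context: Vector inequalities are componentwise; $e_i$ is the $i$-th standard basis vector and $e$ the all-ones vector of $\mathbb{R}^m$; $(a)^+=\max(a,0)$; $\mathrm{conv}$ denotes convex hull. Two-stage adjustable robust problem $\Pi_{AR}(\mathcal{S})$: the data are $A\in\mathbb{R}_+^{m\times n}$, $B\in\mathbb{R}^{m\times n}$, $c,d\in\mathbb{R}^n_+$. For a set $\mathcal{S}\subseteq\mathbb{R}^m_+$, a feasible solution is a pair $(x,y(\cdot))$ with $x\in\mathbb{R}^n_+$, $y:\mathcal{S}\to\mathbb{R}^n_+$ and $Ax+By(h)\ge h$ for all $h\in\mathcal{S}$; the optimal value $z_{AR}(\mathcal{S})$ is the minimum (infimum) over feasible solutions of the worst-case cost $c^Tx+\max_{h\in\mathcal{S}}d^Ty(h)$ (max read as supremum; value $+\infty$ if infeasible). An optimal solution is a feasible solution whose worst-case cost equals $z_{AR}(\mathcal{S})<\infty$. A solution $(x,y(\cdot))$ gives an $\alpha$-approximation for $\Pi_{AR}(\mathcal{U})$ if it is feasible for $\Pi_{AR}(\mathcal{U})$ and $c^Tx+d^Ty(h)\le\alpha\cdot z_{AR}(\mathcal{U})$ for all $h\in\mathcal{U}$. Domination: $\hat{\mathcal{U}}\subseteq\mathbb{R}^m_+$ dominates $\mathcal{U}$ if for every $h\in\mathcal{U}$ there is $\hat h\in\hat{\mathcal{U}}$ with $\hat h\ge h$. Piecewise affine solution with parameters $\beta,\gamma$: let $(\hat x,\hat y(\cdot))$ be an optimal solution (assumed to exist) of $\Pi_{AR}$ over $\beta\cdot\mathrm{conv}(e_1,\dots,e_m,\gamma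 e)$. The piecewise affine solution is $x=2\hat x$, $y(h)=\frac1\beta\sum_{i=1}^m(h_i-\beta\gamma)^+\hat y(\beta e_i)+\hat y(\beta\gamma e)$ for $h\in\mathcal{U}$. *)

theory Defs
  imports "HOL-Analysis.Analysis"
begin

text \<open>
  Vectors of dimension \<open>m\<close> and \<open>n\<close> have types \<open>real^'m\<close> and \<open>real^'n\<close>; the order \<open>\<le>\<close> of the
  library on such vectors is componentwise.
\<close>

definition lp_norm :: "real \<Rightarrow> real^'m \<Rightarrow> real" where
  "lp_norm p h = (\<Sum>i\<in>UNIV. \<bar>h $ i\<bar> powr p) powr (1 / p)"

definition AR_feasible ::
  "real^'n^'m \<Rightarrow> real^'n^'m \<Rightarrow> (real^'m) set \<Rightarrow> real^'n \<Rightarrow> (real^'m \<Rightarrow> real^'n) \<Rightarrow> bool" where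
  "AR_feasible A B S x y \<longleftrightarrow> 0 \<le> x \<and> (\<forall>h\<in>S. 0 \<le> y h \<and> h \<le> A *v x + B *v y h)"

text \<open>
  Costs are extended reals: a policy with unbounded second-stage cost has worst-case cost
  \<open>\<infinity>\<close>, and the infimum over an empty set of feasible solutions is \<open>\<infinity>\<close>.
\<close>

definition AR_cost ::
  "real^'n \<Rightarrow> real^'n \<Rightarrow> (real^'m) set \<Rightarrow> real^'n \<Rightarrow> (real^'m \<Rightarrow> real^'n) \<Rightarrow> ereal" where
  "AR_cost c d S x y = ereal (c \<bullet> x) + (SUP h\<in>S. ereal (d \<bullet> y h))"

definition z_AR ::
  "real^'n^'m \<Rightarrow> real^'n^'m \<Rightarrow> real^'n \<Rightarrow> real^'n \<Rightarrow> (real^'m) set \<Rightarrow> ereal" where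
  "z_AR A B c d S = Inf {AR_cost c d S x y | x y. AR_feasible A B S x y}"

definition AR_optimal ::
  "real^'n^'m \<Rightarrow> real^'n^'m \<Rightarrow> real^'n \<Rightarrow> real^'n \<Rightarrow> (real^'m) set
    \<Rightarrow> real^'n \<Rightarrow> (real^'m \<Rightarrow> real^'n) \<Rightarrow> bool" where
  "AR_optimal A B c d S x y \<longleftrightarrow>
     AR_feasible A B S x y \<and> AR_cost c d S x y = z_AR A B c d S \<and> z_AR A B c d S < \<infinity>"

definition AR_approximation ::
  "real \<Rightarrow> real^'n^'m \<Rightarrow> real^'n^'m \<Rightarrow> real^'n \<Rightarrow> real^'n \<Rightarrow> (real^'m) set
    \<Rightarrow> real^'n \<Rightarrow> (real^'m \<Rightarrow> real^'n) \<Rightarrow> bool" where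
  "AR_approximation \<alpha> A B c d U x y \<longleftrightarrow>
     AR_feasible A B U x y \<and>
     (\<forall>h\<in>U. ereal (c \<bullet> x + d \<bullet> y h) \<le> ereal \<alpha> * z_AR A B c d U)"

definition dominates :: "(real^'m) set \<Rightarrow> (real^'m) set \<Rightarrow> bool" where
  "dominates V U \<longleftrightarrow> V \<subseteq> {h. 0 \<le> h} \<and> (\<forall>h\<in>U. \<exists>h'\<in>V. h \<le> h')"

definition dominating_set :: "real \<Rightarrow> real \<Rightarrow> (real^'m) set" where
  "dominating_set \<beta> \<gamma> =
     (\<lambda>v. \<beta> *\<^sub>R v) ` (convex hull (insert (\<gamma> *\<^sub>R vec 1) (range (\<lambda>i. axis i 1))))"

definition pwa_policy ::
  "real \<Rightarrow> real \<Rightarrow> (real^'m \<Rightarrow> real^'n) \<Rightarrow> real^'m \<Rightarrow> real^'n" where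
  "pwa_policy \<beta> \<gamma> y' h =
     (1 / \<beta>) *\<^sub>R (\<Sum>i\<in>UNIV. max (h $ i - \<beta> * \<gamma>) 0 *\<^sub>R y' (\<beta> *\<^sub>R axis i 1))
       + y' ((\<beta> * \<gamma>) *\<^sub>R vec 1)"

end

theory Submission
  imports Defs
begin

text \<open>
  Put \<open>g = \<beta>\<gamma>\<close>. By Young's inequality \<open>h\<^sub>i \<le> h\<^sub>i\<^sup>s / (s g\<^sup>s\<^sup>-\<^sup>1) + (1 - 1/s) g\<close>, so a bound \<open>R\<close> on the \<open>s\<close>-norm
  with \<open>R\<^sup>s = \<beta>\<^sup>s \<gamma>\<^sup>s\<^sup>-\<^sup>1\<close> yields \<open>\<Sum>\<^sub>i (h\<^sub>i - (1 - 1/s) \<beta>\<gamma>)\<^sup>+ \<le> \<beta>/s\<close>. The values \<open>\<beta>\<^sub>1\<close> and \<open>\<beta>\<^sub>2\<close> solve this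
  equation for \<open>(s, R) = (p, 1)\<close> and \<open>(q, r)\<close>. The inequality exhibits a point of the dominating
  set above \<open>h\<close> that puts weight at least \<open>1 - 1/s\<close> on \<open>\<gamma>e\<close>, and it bounds by \<open>\<beta>\<close> the total excess
  of \<open>h\<close> over \<open>\<beta>\<gamma>e\<close>, so the piecewise affine policy costs at most twice the optimum over the
  dominating set. Conversely \<open>e\<^sub>1, \<dots>, e\<^sub>m, \<gamma>e\<close> belong to \<open>U\<close>, so mixing a policy for \<open>U\<close> linearly
  and scaling it by \<open>\<beta>\<close> covers the dominating set.
\<close>

section \<open>Excess of a vector over a constant level\<close>

text \<open>For \<open>x > 0\<close>, the weighted geometric mean of
  \<open>a = x powr s / g powr (s - 1)\<close> and \<open>g\<close> with weights
  \<open>1 / s\<close> and \<open>1 - 1 / s\<close> is exactly \<open>x\<close>; Young's inequality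
  bounds it by the arithmetic mean. The case \<open>x = 0\<close> is separate because Young's
  inequality is applied to positive numbers.\<close>

lemma Youngs_inequality_excess:
  fixes x g s :: real
  assumes "0 \<le> x" "0 < g" "1 \<le> s"
  shows "max (x - (1 - 1 / s) * g) 0 \<le> x powr s / (s * g powr (s - 1))"
proof (cases "x = 0")
  case True
  then show ?thesis using assms by simp
next
  case False
  then have x: "x > 0" using assms by simp
  define a where "a = x powr s / g powr (s - 1)"
  have a: "a > 0" using x assms by (simp add: a_def)
  have "a powr (1 / s) * g powr (1 - 1 / s) = x"
  proof -
    have "(s - 1) * (1 / s) = 1 - 1 / s" using assms by (simp add: field_simps)
    moreover have "s * (1 / s) = 1" using assms by simp
    ultimately have "a powr (1 / s) = x / g powr (1 - 1 / s)"
      unfolding a_def using x assms by (simp only: powr_divide powr_powr powr_one)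
    then show ?thesis using assms by simp
  qed
  moreover have "a powr (1 / s) * g powr (1 - 1 / s) \<le> 1 / s * a + (1 - 1 / s) * g"
    by (rule Youngs_inequality_0) (use assms a in auto)
  ultimately have "x - (1 - 1 / s) * g \<le> 1 / s * a" by simp
  also have "1 / s * a = x powr s / (s * g powr (s - 1))" by (simp add: a_def)
  finally show ?thesis using assms by simp
qed

text \<open>Summing Young's bound over the coordinates gives at most
  \<open>R powr s / (s * (\<beta> * \<gamma>) powr (s - 1))\<close>, and \<open>eq\<close> is the
  relation that turns this into \<open>\<beta> / s\<close>.\<close>

lemma sum_excess_le:
  fixes h :: "real^'m"
  assumes h: "0 \<le> h" "lp_norm s h \<le> R" and "0 < \<beta>" "0 < \<gamma>" "1 \<le> s" "0 \<le> R"
    and eq: "\<beta> powr s * \<gamma> powr (s - 1) = R powr s"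
  shows "(\<Sum>i\<in>UNIV. max (h $ i - (1 - 1 / s) * (\<beta> * \<gamma>)) 0) \<le> \<beta> / s"
proof -
  define S where "S = (\<Sum>i\<in>UNIV. h $ i powr s)"
  have h0: "0 \<le> h $ i" for i using h by (simp add: less_eq_vec_def)
  have S0: "0 \<le> S" by (simp add: S_def sum_nonneg)
  have "S powr (1 / s) \<le> R" using h h0 by (simp add: lp_norm_def S_def)
  then have "(S powr (1 / s)) powr s \<le> R powr s" using assms by (intro powr_mono2) auto
  then have S: "S \<le> R powr s" using S0 assms by (simp add: powr_powr)
  have g: "0 < \<beta> * \<gamma>" using assms by simp
  have "(\<Sum>i\<in>UNIV. max (h $ i - (1 - 1 / s) * (\<beta> * \<gamma>)) 0)
      \<le> (\<Sum>i\<in>UNIV. h $ i powr s / (s * (\<beta> * \<gamma>) powr (s - 1)))"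
    using Youngs_inequality_excess[OF h0 g \<open>1 \<le> s\<close>] by (intro sum_mono)
  also have "\<dots> = S / (s * (\<beta> * \<gamma>) powr (s - 1))"
    by (simp add: S_def sum_divide_distrib)
  also have "\<dots> \<le> R powr s / (s * (\<beta> * \<gamma>) powr (s - 1))"
    using S assms by (intro divide_right_mono) auto
  also have "\<dots> = \<beta> / s"
  proof -
    have "\<beta> powr s = \<beta> * \<beta> powr (s - 1)" using assms by (simp add: powr_diff)
    with eq have "R powr s = \<beta> * (\<beta> * \<gamma>) powr (s - 1)" using assms by (simp add: powr_mult)
    then show ?thesis using assms by simp
  qed
  finally show ?thesis .
qed

section \<open>Points of the dominating set\<close>

declare vec_1 [simp del] \<comment> \<open>keeps the form \<open>vec 1\<close> in which the dominating set is defined\<close>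

abbreviation simplex_vertices :: "real \<Rightarrow> (real^'m) set" where
  "simplex_vertices \<gamma> \<equiv> insert (\<gamma> *\<^sub>R vec 1) (range (\<lambda>i. axis i 1))"

text \<open>The slack \<open>1 - sum u UNIV\<close> is the weight of
  \<open>\<gamma> *\<^sub>R vec 1\<close>. Indexing by \<open>'m option\<close>, with
  \<open>None\<close> for this extra vertex, keeps the sum correct even if it coincides with a basis
  vector, as for dimension 1 and \<open>\<gamma> = 1\<close>.\<close>

lemma simplex_combination_in_hull:
  fixes u :: "'m::finite \<Rightarrow> real"
  assumes "\<And>i. 0 \<le> u i" "sum u UNIV \<le> 1"
  shows "(1 - sum u UNIV) *\<^sub>R (\<gamma> *\<^sub>R vec 1) + (\<Sum>i\<in>UNIV. u i *\<^sub>R axis i 1)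
    \<in> convex hull (simplex_vertices \<gamma> :: (real^'m) set)"
proof -
  define w where "w = case_option (1 - sum u UNIV) u"
  define v :: "'m option \<Rightarrow> real^'m" where "v = case_option (\<gamma> *\<^sub>R vec 1) (\<lambda>i. axis i 1)"
  have split: "sum f UNIV = f None + (\<Sum>i\<in>UNIV. f (Some i))" for f :: "'m option \<Rightarrow> 'b::comm_monoid_add"
    by (simp add: UNIV_option_conv sum.reindex)
  have "(\<Sum>j\<in>UNIV. w j *\<^sub>R v j) \<in> convex hull (simplex_vertices \<gamma>)"
  proof (rule convex_sum)
    show "sum w UNIV = 1" by (simp add: split w_def)
    show "0 \<le> w j" for j using assms by (cases j) (auto simp: w_def)
    show "v j \<in> convex hull (simplex_vertices \<gamma>)" for j
      by (rule hull_inc) (cases j; simp add: v_def)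
  qed (auto simp: convex_convex_hull)
  then show ?thesis by (simp add: split w_def v_def)
qed

text \<open>Weight \<open>u i\<close>, the excess of \<open>h $ i\<close> over the level
  \<open>t * (\<beta> * \<gamma>)\<close> divided by \<open>\<beta>\<close>, goes on the
  \<open>i\<close>-th basis vector. By \<open>le\<close> at least \<open>t\<close> remains for
  \<open>\<gamma> *\<^sub>R vec 1\<close>, which after scaling by \<open>\<beta>\<close> lifts every
  coordinate to that level.\<close>

lemma dominating_point_exists:
  fixes h :: "real^'m"
  assumes "0 < \<beta>" "0 \<le> \<gamma>" "0 \<le> t"
    and le: "(\<Sum>i\<in>UNIV. max (h $ i - t * (\<beta> * \<gamma>)) 0) \<le> (1 - t) * \<beta>"
  shows "\<exists>h'\<in>dominating_set \<beta> \<gamma>. h \<le> h'"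
proof -
  define u where "u i = max (h $ i - t * (\<beta> * \<gamma>)) 0 / \<beta>" for i
  have u0: "0 \<le> u i" for i using assms by (simp add: u_def)
  have "sum u UNIV = (\<Sum>i\<in>UNIV. max (h $ i - t * (\<beta> * \<gamma>)) 0) / \<beta>"
    by (simp add: u_def[abs_def] sum_divide_distrib)
  also have "\<dots> \<le> 1 - t" using le assms by (simp add: divide_le_eq)
  finally have su: "sum u UNIV \<le> 1 - t" .
  define v :: "real^'m" where
    "v = (1 - sum u UNIV) *\<^sub>R (\<gamma> *\<^sub>R vec 1) + (\<Sum>i\<in>UNIV. u i *\<^sub>R axis i 1)"
  have "v \<in> convex hull (simplex_vertices \<gamma>)"
    unfolding v_def by (rule simplex_combination_in_hull) (use u0 su assms in auto)
  then have "\<beta> *\<^sub>R v \<in> dominating_set \<beta> \<gamma>" unfolding dominating_set_def by (rule imageI)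
  moreover have "h \<le> \<beta> *\<^sub>R v"
    unfolding less_eq_vec_def
  proof
    fix j
    have "(\<Sum>i\<in>UNIV. u i * (axis i 1 :: real^'m) $ j) = u j"
      by (simp add: axis_def if_distrib cong: if_cong)
    then have "(\<beta> *\<^sub>R v) $ j = \<beta> * \<gamma> * (1 - sum u UNIV) + \<beta> * u j"
      by (simp add: v_def algebra_simps)
    moreover have "\<beta> * \<gamma> * t \<le> \<beta> * \<gamma> * (1 - sum u UNIV)"
      using su assms by (intro mult_left_mono) auto
    moreover have "h $ j - t * (\<beta> * \<gamma>) \<le> \<beta> * u j" using assms by (simp add: u_def)
    ultimately show "h $ j \<le> (\<beta> *\<^sub>R v) $ j" by (simp add: algebra_simps)
  qed
  ultimately show ?thesis by blast
qed

lemma dominating_set_nonneg: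
  assumes "0 \<le> \<beta>" "0 \<le> \<gamma>"
  shows "dominating_set \<beta> \<gamma> \<subseteq> {h :: real^'m. 0 \<le> h}"
proof -
  have "convex hull (simplex_vertices \<gamma>) \<subseteq> {h :: real^'m. 0 \<le> h}"
  proof (rule hull_minimal)
    show "simplex_vertices \<gamma> \<subseteq> {h :: real^'m. 0 \<le> h}"
      using assms by (auto simp: less_eq_vec_def axis_def)
    show "convex {h :: real^'m. 0 \<le> h}"
      unfolding convex_def by (auto simp: less_eq_vec_def)
  qed
  then show ?thesis using assms by (fastforce simp: dominating_set_def less_eq_vec_def)
qed

lemma vertices_in_dominating_set:
  shows "\<beta> *\<^sub>R axis i 1 \<in> dominating_set \<beta> \<gamma>" "(\<beta> * \<gamma>) *\<^sub>R vec 1 \<in> dominating_set \<beta> \<gamma>"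
proof -
  have "\<beta> *\<^sub>R v \<in> dominating_set \<beta> \<gamma>" if "v \<in> simplex_vertices \<gamma>" for v
    unfolding dominating_set_def by (intro imageI hull_inc that)
  from this[of "axis i 1"] this[of "\<gamma> *\<^sub>R vec 1"]
  show "\<beta> *\<^sub>R axis i 1 \<in> dominating_set \<beta> \<gamma>" "(\<beta> * \<gamma>) *\<^sub>R vec 1 \<in> dominating_set \<beta> \<gamma>"
    by auto
qed

section \<open>Bounds on worst-case costs and optimal values\<close>

lemma inner_nonneg_vec:
  fixes c x :: "real^'n"
  assumes "0 \<le> c" "0 \<le> x"
  shows "0 \<le> c \<bullet> x"
  using assms by (auto simp: inner_vec_def less_eq_vec_def intro!: sum_nonneg)

lemma matrix_vector_mult_nonneg:
  fixes A :: "real^'n^'m"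
  assumes "\<And>i j. 0 \<le> A $ i $ j" "0 \<le> x"
  shows "0 \<le> A *v x"
  using assms by (auto simp: matrix_vector_mult_def less_eq_vec_def intro!: sum_nonneg)

lemma AR_cost_ge_point:
  assumes "h \<in> S"
  shows "ereal (c \<bullet> x + d \<bullet> y h) \<le> AR_cost c d S x y"
  unfolding AR_cost_def plus_ereal.simps(1)[symmetric]
  using assms by (intro add_left_mono SUP_upper)

text \<open>Nonemptiness rules out a supremum over the empty set, which is
  \<open>-\<infinity>\<close>. Together with the finiteness in \<open>AR_optimal\<close>, this bound
  makes the optimum over the dominating set a real number.\<close>

lemma z_AR_nonneg:
  assumes "0 \<le> c" "0 \<le> d" "S \<noteq> {}"
  shows "0 \<le> z_AR A B c d S"
  unfolding z_AR_def
proof (rule Inf_greatest, clarify)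
  fix x y assume f: "AR_feasible A B S x y"
  obtain h where h: "h \<in> S" using assms by blast
  then have "0 \<le> c \<bullet> x + d \<bullet> y h"
    using f assms by (auto simp: AR_feasible_def intro!: add_nonneg_nonneg inner_nonneg_vec)
  then have "0 \<le> ereal (c \<bullet> x + d \<bullet> y h)" by simp
  also have "\<dots> \<le> AR_cost c d S x y" by (rule AR_cost_ge_point[OF h])
  finally show "0 \<le> AR_cost c d S x y" .
qed

lemma z_AR_le:
  assumes "AR_feasible A B S x y" and "S \<noteq> {}"
    and "\<And>h. h \<in> S \<Longrightarrow> c \<bullet> x + d \<bullet> y h \<le> M"
  shows "z_AR A B c d S \<le> ereal M"
proof -
  have "z_AR A B c d S \<le> AR_cost c d S x y"
    unfolding z_AR_def using assms by (intro Inf_lower) blast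
  also have "\<dots> \<le> ereal (c \<bullet> x) + ereal (M - c \<bullet> x)"
    unfolding AR_cost_def
  proof (intro add_left_mono SUP_least)
    fix h assume "h \<in> S"
    then show "ereal (d \<bullet> y h) \<le> ereal (M - c \<bullet> x)" using assms(3)[of h] by simp
  qed
  finally show ?thesis by simp
qed

text \<open>With the first stage \<open>x\<close> fixed, coverage and cost are affine in the second
  stage, so second-stage decisions at the vertices extend to their convex hull at total cost at most
  \<open>M\<close>. Scaling demand and both decisions by \<open>\<beta>\<close> scales the cost by
  \<open>\<beta>\<close>.\<close>

lemma z_AR_dominating_set_le:
  fixes A B :: "real^'n^'m"
  assumes "0 < \<beta>" and c: "0 \<le> c" and d: "0 \<le> d"
    and V: "simplex_vertices \<gamma> \<subseteq> U"
    and f: "AR_feasible A B U x y" and M: "AR_cost c d U x y \<le> ereal M"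
  shows "z_AR A B c d (dominating_set \<beta> \<gamma>) \<le> ereal (\<beta> * M)"
proof -
  \<comment> \<open>\<open>G\<close> collects the demands that \<open>x\<close> can serve within the
    budget \<open>M\<close>; it is convex and contains the vertices, hence their hull.\<close>
  define G where "G = {v. \<exists>w\<ge>0. v \<le> A *v x + B *v w \<and> c \<bullet> x + d \<bullet> w \<le> M}"
  have "convex G"
  proof (rule convexI)
    fix v v' and a b :: real
    assume "v \<in> G" "v' \<in> G" and ab: "0 \<le> a" "0 \<le> b" "a + b = 1"
    then obtain w w' where w: "0 \<le> w" "v \<le> A *v x + B *v w" "c \<bullet> x + d \<bullet> w \<le> M"
      and w': "0 \<le> w'" "v' \<le> A *v x + B *v w'" "c \<bullet> x + d \<bullet> w' \<le> M"
      unfolding G_def by blast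
    have b: "b = 1 - a" using ab by simp
    have "0 \<le> a *\<^sub>R w + b *\<^sub>R w'" using w w' ab by (simp add: less_eq_vec_def)
    moreover have "a *\<^sub>R v + b *\<^sub>R v' \<le> A *v x + B *v (a *\<^sub>R w + b *\<^sub>R w')"
    proof -
      have "a *\<^sub>R v + b *\<^sub>R v' \<le> a *\<^sub>R (A *v x + B *v w) + b *\<^sub>R (A *v x + B *v w')"
        using w w' ab by (auto simp: less_eq_vec_def intro!: add_mono mult_left_mono)
      also have "\<dots> = (a + b) *\<^sub>R (A *v x) + B *v (a *\<^sub>R w + b *\<^sub>R w')"
        by (simp add: matrix_vector_right_distrib matrix_vector_mult_scaleR algebra_simps)
      finally show ?thesis using ab by simp
    qed
    moreover have "c \<bullet> x + d \<bullet> (a *\<^sub>R w + b *\<^sub>R w') \<le> M"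
    proof -
      have "c \<bullet> x + d \<bullet> (a *\<^sub>R w + b *\<^sub>R w') = a * (c \<bullet> x + d \<bullet> w) + b * (c \<bullet> x + d \<bullet> w')"
        by (simp add: b inner_add_right algebra_simps)
      also have "\<dots> \<le> M" using w w' ab by (intro convex_bound_le) auto
      finally show ?thesis .
    qed
    ultimately show "a *\<^sub>R v + b *\<^sub>R v' \<in> G" unfolding G_def by blast
  qed
  moreover have "simplex_vertices \<gamma> \<subseteq> G"
  proof
    fix v :: "real^'m" assume "v \<in> simplex_vertices \<gamma>"
    then have v: "v \<in> U" using V by blast
    then have "ereal (c \<bullet> x + d \<bullet> y v) \<le> ereal M" using M by (blast intro: order_trans AR_cost_ge_point)
    then show "v \<in> G" using f v unfolding G_def AR_feasible_def by auto
  qed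
  ultimately have hull: "convex hull (simplex_vertices \<gamma>) \<subseteq> G" by (rule hull_minimal[rotated])
  have "\<exists>w\<ge>0. h \<le> A *v (\<beta> *\<^sub>R x) + B *v w \<and> c \<bullet> (\<beta> *\<^sub>R x) + d \<bullet> w \<le> \<beta> * M"
    if h: "h \<in> dominating_set \<beta> \<gamma>" for h
  proof -
    obtain v where v: "h = \<beta> *\<^sub>R v" "v \<in> G" using h hull by (auto simp: dominating_set_def)
    then obtain w where w: "0 \<le> w" "v \<le> A *v x + B *v w" "c \<bullet> x + d \<bullet> w \<le> M"
      unfolding G_def by blast
    have "\<beta> *\<^sub>R v \<le> \<beta> *\<^sub>R (A *v x + B *v w)"
      using w \<open>0 < \<beta>\<close> by (auto simp: less_eq_vec_def intro!: mult_left_mono)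
    moreover have "\<beta> * (c \<bullet> x + d \<bullet> w) \<le> \<beta> * M" using w \<open>0 < \<beta>\<close> by simp
    moreover have "0 \<le> \<beta> *\<^sub>R w" using w \<open>0 < \<beta>\<close> by (simp add: less_eq_vec_def)
    ultimately show ?thesis
      by (intro exI[of _ "\<beta> *\<^sub>R w"])
        (simp add: v matrix_vector_mult_scaleR algebra_simps)
  qed
  then obtain Y where Y: "\<And>h. h \<in> dominating_set \<beta> \<gamma> \<Longrightarrow> 0 \<le> Y h \<and>
      h \<le> A *v (\<beta> *\<^sub>R x) + B *v Y h \<and> c \<bullet> (\<beta> *\<^sub>R x) + d \<bullet> Y h \<le> \<beta> * M"
    by metis
  have "0 \<le> \<beta> *\<^sub>R x" using f \<open>0 < \<beta>\<close> by (simp add: AR_feasible_def less_eq_vec_def)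
  with Y have "AR_feasible A B (dominating_set \<beta> \<gamma>) (\<beta> *\<^sub>R x) Y" by (simp add: AR_feasible_def)
  then show ?thesis using Y vertices_in_dominating_set(2) by (intro z_AR_le) blast+
qed

text \<open>\<open>Z / \<beta>\<close> is a lower bound for every feasible cost over
  \<open>U\<close>. Testing each cost against its real upper bounds \<open>M\<close> also handles
  infinite costs, and an infinite \<open>z_AR\<close> over \<open>U\<close>, without a case
  split.\<close>

lemma z_AR_dominating_set_le_scaled:
  fixes A B :: "real^'n^'m"
  assumes "0 < \<beta>" and c: "0 \<le> c" and d: "0 \<le> d"
    and V: "simplex_vertices \<gamma> \<subseteq> U"
    and Z: "z_AR A B c d (dominating_set \<beta> \<gamma>) = ereal Z"
  shows "ereal Z \<le> ereal \<beta> * z_AR A B c d U"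
proof -
  have "ereal (Z / \<beta>) \<le> z_AR A B c d U"
    unfolding z_AR_def
  proof (rule Inf_greatest, clarify)
    fix x y assume f: "AR_feasible A B U x y"
    show "ereal (Z / \<beta>) \<le> AR_cost c d U x y"
    proof (rule ereal_le_real)
      fix M assume "AR_cost c d U x y \<le> ereal M"
      from z_AR_dominating_set_le[OF assms(1-4) f this] Z \<open>0 < \<beta>\<close>
      show "ereal (Z / \<beta>) \<le> ereal M" by (simp add: divide_le_eq mult.commute)
    qed
  qed
  then have "ereal \<beta> * ereal (Z / \<beta>) \<le> ereal \<beta> * z_AR A B c d U"
    using \<open>0 < \<beta>\<close> by (intro ereal_mult_left_mono) auto
  then show ?thesis using \<open>0 < \<beta>\<close> by simp
qed

section \<open>Feasibility and cost of the piecewise affine policy\<close>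

text \<open>Each \<open>h $ i\<close> is at most \<open>\<beta> * \<gamma>\<close> plus its excess.
  One copy of \<open>x'\<close> with the weighted decisions at
  \<open>\<beta> *\<^sub>R axis i 1\<close> covers the excess, the other with the decision at
  \<open>(\<beta> * \<gamma>) *\<^sub>R vec 1\<close> covers the level. Each copy costs at most
  \<open>Z\<close>, the optimum over the dominating set.\<close>

lemma pwa_policy_approximation:
  fixes A B :: "real^'n^'m"
  assumes A: "\<And>i j. 0 \<le> A $ i $ j" and c: "0 \<le> c" and d: "0 \<le> d" and \<beta>: "0 < \<beta>"
    and V: "simplex_vertices \<gamma> \<subseteq> U"
    and excess: "\<And>h. h \<in> U \<Longrightarrow> (\<Sum>i\<in>UNIV. max (h $ i - \<beta> * \<gamma>) 0) \<le> \<beta>"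
    and opt: "AR_optimal A B c d (dominating_set \<beta> \<gamma>) x' y'"
  shows "AR_approximation (2 * \<beta>) A B c d U (2 *\<^sub>R x') (pwa_policy \<beta> \<gamma> y')"
proof -
  let ?D = "dominating_set \<beta> \<gamma> :: (real^'m) set"
  have ne: "?D \<noteq> {}" using vertices_in_dominating_set by blast
  have x': "0 \<le> x'" and y': "\<And>h. h \<in> ?D \<Longrightarrow> 0 \<le> y' h \<and> h \<le> A *v x' + B *v y' h"
    using opt by (auto simp: AR_optimal_def AR_feasible_def)
  have "0 \<le> z_AR A B c d ?D" "z_AR A B c d ?D < \<infinity>"
    using z_AR_nonneg[OF c d ne] opt by (auto simp: AR_optimal_def)
  then obtain Z where Z: "z_AR A B c d ?D = ereal Z" by (cases "z_AR A B c d ?D") auto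
  have cost: "c \<bullet> x' + d \<bullet> y' h \<le> Z" if "h \<in> ?D" for h
    using AR_cost_ge_point[OF that, of c x' d y'] opt Z by (simp add: AR_optimal_def)
  define a where "a i = \<beta> *\<^sub>R (axis i 1 :: real^'m)" for i
  define g :: "real^'m" where "g = (\<beta> * \<gamma>) *\<^sub>R vec 1"
  have aD: "a i \<in> ?D" and gD: "g \<in> ?D" for i
    by (simp_all add: a_def g_def vertices_in_dominating_set)
  have Ax: "0 \<le> A *v x'" by (rule matrix_vector_mult_nonneg[OF A x'])
  have cx: "0 \<le> c \<bullet> x'" by (rule inner_nonneg_vec[OF c x'])
  have main: "0 \<le> pwa_policy \<beta> \<gamma> y' h \<and>
      h \<le> A *v (2 *\<^sub>R x') + B *v pwa_policy \<beta> \<gamma> y' h \<and>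
      c \<bullet> (2 *\<^sub>R x') + d \<bullet> pwa_policy \<beta> \<gamma> y' h \<le> 2 * Z" if h: "h \<in> U" for h
  proof -
    define w where "w i = max (h $ i - \<beta> * \<gamma>) 0 / \<beta>" for i
    have w0: "0 \<le> w i" for i using \<beta> by (simp add: w_def)
    have w1: "sum w UNIV \<le> 1"
      using excess[OF h] \<beta> by (simp add: w_def[abs_def] sum_divide_distrib[symmetric])
    define P where "P = pwa_policy \<beta> \<gamma> y' h"
    have P: "P = (\<Sum>i\<in>UNIV. w i *\<^sub>R y' (a i)) + y' g"
      by (simp add: P_def pwa_policy_def w_def a_def g_def scaleR_sum_right)
    have "0 \<le> P"
      using y'[OF gD] y'[OF aD] w0
      by (auto simp: P less_eq_vec_def sum_component intro!: add_nonneg_nonneg sum_nonneg mult_nonneg_nonneg)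
    moreover have "h \<le> A *v (2 *\<^sub>R x') + B *v P"
      unfolding less_eq_vec_def
    proof
      fix j
      let ?A = "(A *v x') $ j"
      have BP: "(B *v P) $ j = (\<Sum>i\<in>UNIV. w i * (B *v y' (a i)) $ j) + (B *v y' g) $ j"
        unfolding P by (simp add: matrix_vector_right_distrib linear_sum[OF matrix_vector_mul_linear]
          matrix_vector_mult_scaleR sum_component)
      have "h $ j - \<beta> * \<gamma> \<le> \<beta> * w j" using \<beta> by (simp add: w_def)
      also have "\<beta> * w j = (\<Sum>i\<in>UNIV. w i * a i $ j)"
        by (simp add: a_def axis_def if_distrib mult.commute cong: if_cong)
      also have "\<dots> \<le> (\<Sum>i\<in>UNIV. w i * (?A + (B *v y' (a i)) $ j))"
        using y'[OF aD] w0 by (intro sum_mono mult_left_mono) (auto simp: less_eq_vec_def)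
      also have "\<dots> = sum w UNIV * ?A + (\<Sum>i\<in>UNIV. w i * (B *v y' (a i)) $ j)"
        by (simp add: distrib_left sum.distrib sum_distrib_right)
      \<comment> \<open>The weights may sum to less than 1; a full copy of \<open>x'\<close> still
        suffices because \<open>A *v x'\<close> is nonnegative.\<close>
      also have "\<dots> \<le> ?A + (\<Sum>i\<in>UNIV. w i * (B *v y' (a i)) $ j)"
        using w1 Ax mult_right_mono[of "sum w UNIV" 1 ?A] by (simp add: less_eq_vec_def)
      finally have "h $ j - \<beta> * \<gamma> \<le> ?A + (\<Sum>i\<in>UNIV. w i * (B *v y' (a i)) $ j)" .
      moreover have "\<beta> * \<gamma> \<le> ?A + (B *v y' g) $ j"
      proof -
        have "g $ j = \<beta> * \<gamma>" by (simp add: g_def)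
        then show ?thesis using y'[OF gD] by (metis less_eq_vec_def vector_add_component)
      qed
      ultimately show "h $ j \<le> (A *v (2 *\<^sub>R x') + B *v P) $ j"
        by (simp add: BP matrix_vector_mult_scaleR)
    qed
    moreover have "c \<bullet> (2 *\<^sub>R x') + d \<bullet> P \<le> 2 * Z"
    proof -
      have "d \<bullet> P = (\<Sum>i\<in>UNIV. w i * (d \<bullet> y' (a i))) + d \<bullet> y' g"
        by (simp add: P inner_add_right inner_sum_right)
      moreover have "(\<Sum>i\<in>UNIV. w i * (d \<bullet> y' (a i))) \<le> (\<Sum>i\<in>UNIV. w i * (Z - c \<bullet> x'))"
        using cost[OF aD] w0 by (intro sum_mono mult_left_mono) (auto simp: algebra_simps)
      \<comment> \<open>As the weights sum to at most 1, it is enough that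
        \<open>Z - c \<bullet> x'\<close> is nonnegative, which follows from the cost bound at
        \<open>g\<close>.\<close>
      moreover have "\<dots> \<le> Z - c \<bullet> x'"
      proof -
        have "0 \<le> d \<bullet> y' g" using y'[OF gD] d by (simp add: inner_nonneg_vec)
        then have "0 \<le> Z - c \<bullet> x'" using cost[OF gD] by simp
        then show ?thesis using w1 mult_right_mono[of "sum w UNIV" 1 "Z - c \<bullet> x'"]
          by (simp add: sum_distrib_right)
      qed
      ultimately show ?thesis using cost[OF gD] by simp
    qed
    ultimately show ?thesis by (simp add: P_def)
  qed
  have "0 \<le> 2 *\<^sub>R x'" using x' by (simp add: less_eq_vec_def)
  then have "AR_feasible A B U (2 *\<^sub>R x') (pwa_policy \<beta> \<gamma> y')"
    using main by (simp add: AR_feasible_def)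
  moreover have "ereal (c \<bullet> (2 *\<^sub>R x') + d \<bullet> pwa_policy \<beta> \<gamma> y' h) \<le> ereal (2 * \<beta>) * z_AR A B c d U"
    if "h \<in> U" for h
  proof -
    have "ereal (c \<bullet> (2 *\<^sub>R x') + d \<bullet> pwa_policy \<beta> \<gamma> y' h) \<le> ereal 2 * ereal Z"
      using main[OF that] by simp
    also have "\<dots> \<le> ereal 2 * (ereal \<beta> * z_AR A B c d U)"
      by (intro ereal_mult_left_mono z_AR_dominating_set_le_scaled[OF \<beta> c d V Z]) simp
    also have "\<dots> = ereal (2 * \<beta>) * z_AR A B c d U"
      by (simp add: mult.assoc[symmetric])
    finally show ?thesis .
  qed
  ultimately show ?thesis by (simp add: AR_approximation_def)
qed

section \<open>Norms of the vertices and the choice of constants\<close>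

lemma lp_norm_axis:
  assumes "0 < s"
  shows "lp_norm s (axis i 1 :: real^'m) = 1"
proof -
  have "\<bar>(axis i 1 :: real^'m) $ j\<bar> powr s = (if j = i then 1 else 0)" for j
    by (simp add: axis_def)
  then show ?thesis by (simp add: lp_norm_def)
qed

lemma lp_norm_constant:
  assumes "0 < s" "0 \<le> \<gamma>"
  shows "lp_norm s (\<gamma> *\<^sub>R vec 1 :: real^'m) = real CARD('m) powr (1 / s) * \<gamma>"
  using assms by (simp add: lp_norm_def powr_mult powr_powr)

theorem mainTheorem6:
  fixes A B :: "real^'n^'m" and c d :: "real^'n"
    and U U1 U2 :: "(real^'m) set"
    and p q r \<beta> \<beta>1 \<beta>2 \<gamma> :: real
  assumes "\<And>i j. 0 \<le> A $ i $ j" and "0 \<le> c" and "0 \<le> d"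
    and "p > q" and "q \<ge> 1"
    and "real CARD('m) powr (1 / q - 1 / p) \<ge> r" and "r \<ge> 1"
    and "U1 = {h. 0 \<le> h \<and> lp_norm p h \<le> 1}"
    and "U2 = {h. 0 \<le> h \<and> lp_norm q h \<le> r}"
    and "U = U1 \<inter> U2"
    and "\<beta>1 = r powr ((1 - p) / p) * real CARD('m) powr ((p - 1) / (p * q))"
    and "\<beta>2 = r powr (1 / q) * real CARD('m) powr ((q - 1) / q\<^sup>2)"
    and "\<beta> = min \<beta>1 \<beta>2"
    and "\<gamma> = r * real CARD('m) powr (- 1 / q)"
  shows "dominates (dominating_set \<beta> \<gamma>) U \<and>
    (\<forall>x' y'. AR_optimal A B c d (dominating_set \<beta> \<gamma>) x' y' \<longrightarrow>
      AR_approximation (2 * \<beta>) A B c d U (2 *\<^sub>R x') (pwa_policy \<beta> \<gamma> y'))"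
proof -
  note [simp] = less_eq_vec_def
  define m where "m = real CARD('m)"
  have m: "0 < m" by (simp add: m_def)
  have r: "0 < r" and p: "1 < p" using assms(4,5,7) by auto
  have \<gamma>: "0 < \<gamma>" using r by (simp add: assms(14))
  have \<beta>1: "0 < \<beta>1" using r by (simp add: assms(11))
  have \<beta>2: "0 < \<beta>2" using r by (simp add: assms(12))
  have \<beta>: "0 < \<beta>" using \<beta>1 \<beta>2 by (simp add: assms(13))
  \<comment> \<open>Taking logarithms turns the relations for \<open>\<beta>1\<close> and
    \<open>\<beta>2\<close> into linear identities in \<open>ln r\<close> and
    \<open>ln m\<close>.\<close>
  have ln_\<gamma>: "ln \<gamma> = ln r - ln m / q"
    using m r by (simp add: assms(14) m_def[symmetric] ln_mult ln_powr)
  have ln_\<beta>1: "ln \<beta>1 = (1 - p) / p * ln r + (p - 1) / (p * q) * ln m"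
    using m r by (simp add: assms(11) m_def[symmetric] ln_mult ln_powr)
  have ln_\<beta>2: "ln \<beta>2 = 1 / q * ln r + (q - 1) / q\<^sup>2 * ln m"
    using m r by (simp add: assms(12) m_def[symmetric] ln_mult ln_powr)
  have eq1: "\<beta>1 powr p * \<gamma> powr (p - 1) = 1 powr p"
  proof -
    have "p * ln \<beta>1 + (p - 1) * ln \<gamma> = 0"
      unfolding ln_\<beta>1 ln_\<gamma> using p assms(5) by (simp add: field_simps)
    then show ?thesis using \<beta>1 \<gamma> by (simp add: powr_def exp_add[symmetric])
  qed
  have eq2: "\<beta>2 powr q * \<gamma> powr (q - 1) = r powr q"
  proof -
    have "q * ln \<beta>2 + (q - 1) * ln \<gamma> = q * ln r"
      unfolding ln_\<beta>2 ln_\<gamma> using assms(5) by (simp add: field_simps power2_eq_square)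
    then show ?thesis using \<beta>2 \<gamma> r by (simp add: powr_def exp_add[symmetric])
  qed
  \<comment> \<open>The constraint attaining the minimum in \<open>\<beta>\<close> supplies the
    exponent: \<open>s = p\<close> with bound 1, or \<open>s = q\<close> with bound
    \<open>r\<close>.\<close>
  have "\<exists>s\<ge>1. \<forall>h\<in>U. (\<Sum>i\<in>UNIV. max (h $ i - (1 - 1 / s) * (\<beta> * \<gamma>)) 0) \<le> \<beta> / s"
  proof (cases "\<beta>1 \<le> \<beta>2")
    case True
    then have "\<beta> = \<beta>1" by (simp add: assms(13))
    then show ?thesis
      using p sum_excess_le[OF _ _ \<beta>1 \<gamma> _ _ eq1]
      by (intro exI[of _ p]) (auto simp: assms(8-10))
  next
    case False
    then have "\<beta> = \<beta>2" by (simp add: assms(13))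
    then show ?thesis
      using assms(5) r sum_excess_le[OF _ _ \<beta>2 \<gamma> _ _ eq2]
      by (intro exI[of _ q]) (auto simp: assms(8-10))
  qed
  then obtain s where s: "1 \<le> s"
    and ex: "\<And>h. h \<in> U \<Longrightarrow> (\<Sum>i\<in>UNIV. max (h $ i - (1 - 1 / s) * (\<beta> * \<gamma>)) 0) \<le> \<beta> / s"
    by blast
  \<comment> \<open>With \<open>t = 1 - 1 / s\<close> the admissible excess
    \<open>(1 - t) * \<beta>\<close> is exactly \<open>\<beta> / s\<close>.\<close>
  have "\<exists>h'\<in>dominating_set \<beta> \<gamma>. h \<le> h'" if "h \<in> U" for h
    using ex[OF that] s \<beta> \<gamma> by (intro dominating_point_exists[where t = "1 - 1 / s"]) auto
  then have dom: "dominates (dominating_set \<beta> \<gamma>) U"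
    using dominating_set_nonneg[of \<beta> \<gamma>] \<beta> \<gamma> unfolding dominates_def by auto
  have excess: "(\<Sum>i\<in>UNIV. max (h $ i - \<beta> * \<gamma>) 0) \<le> \<beta>" if "h \<in> U" for h
  proof -
    have "(1 - 1 / s) * (\<beta> * \<gamma>) \<le> 1 * (\<beta> * \<gamma>)"
      using s \<beta> \<gamma> by (intro mult_right_mono) auto
    then have "(\<Sum>i\<in>UNIV. max (h $ i - \<beta> * \<gamma>) 0)
        \<le> (\<Sum>i\<in>UNIV. max (h $ i - (1 - 1 / s) * (\<beta> * \<gamma>)) 0)"
      by (intro sum_mono max.mono) auto
    also have "\<dots> \<le> \<beta> / s" by (rule ex[OF that])
    also have "\<dots> \<le> \<beta>" using s \<beta> by (simp add: divide_le_eq)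
    finally show ?thesis .
  qed
  \<comment> \<open>Here the upper bound on \<open>r\<close> enters; the \<open>q\<close>-norm of
    the same vector is exactly \<open>r\<close> by the choice of \<open>\<gamma>\<close>.\<close>
  have "lp_norm p (\<gamma> *\<^sub>R vec 1 :: real^'m) \<le> 1"
  proof -
    have "m powr (1 / p) * \<gamma> = r / m powr (1 / q - 1 / p)"
      using m by (simp add: assms(14) m_def[symmetric] powr_diff powr_minus field_simps)
    also have "\<dots> \<le> 1" using assms(6) m by (simp add: m_def[symmetric])
    finally show ?thesis using p \<gamma> by (simp add: lp_norm_constant m_def)
  qed
  moreover have "lp_norm q (\<gamma> *\<^sub>R vec 1 :: real^'m) \<le> r"
  proof -
    have "m powr (1 / q) * \<gamma> = r"
      using m by (simp add: assms(14) m_def[symmetric] powr_minus)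
    then show ?thesis using assms(5) \<gamma> by (simp add: lp_norm_constant m_def)
  qed
  ultimately have "\<gamma> *\<^sub>R vec 1 \<in> U" using \<gamma> by (simp add: assms(8-10))
  moreover have "axis i 1 \<in> U" for i
  proof -
    have "0 \<le> (axis i 1 :: real^'m)" by (simp add: axis_def)
    then show ?thesis using p assms(5,7) by (simp add: assms(8-10) lp_norm_axis)
  qed
  ultimately have "simplex_vertices \<gamma> \<subseteq> U" by blast
  with pwa_policy_approximation[OF assms(1-3) \<beta> _ excess] dom show ?thesis by blast
qed

end
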